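(* Let $n\ge3$ and $t\in\{1,\dots,n-2\}$. The elements of $\mathcal{K}$ other than $\alpha_{n,t}$ and $\alpha_{n,t+1}$ are in bijection with the subsets $S\subseteq[n]$ satisfying $|S|\in\{1,n-1\}$ or $\min(t+1,n-t)<|S|<\max(t+1,n-t)$, the bijection being given by $$S\mapsto\sum_{k\in S}\beta_{n,t,k}-\max(0,|S|-(t+1))\,\alpha_{n,t}-\max(0,|S|-(n-t))\,\alpha_{n,t+1}.$$
   Context: A function $f\colon 2^{[n]}\to\mathbb{R}$ is supermodular if $f(I\cap J)+f(I\cup J)\ge f(I)+f(J)$ for all $I,J$, and modular if equality always holds. A supermodular $f$ is irreducible if it is not modular and whenever $f=g_1+g_2$ with $g_1,g_2$ supermodular, each $g_i$ differs from $c_if$ by a modular function for some $c_i\ge0$. A supermodular function is standard if $f(I)=0$ for all $|I|\le1$ and $f$ takes nonnegative integer values with greatest common divisor $1$ (each irreducible function is equivalent, up to modular functions and positive scaling, to a unique standard one). An unordered pair $\{I,J\}$ of subsets of $[n]$ is close if $|I|=|J|=|I\cap J|+1=|I\cup J|-1$; for such a pair set $s_{I,J}=f(I\cap J)+f(I\cup J)-f(I)-f(J)$. $\mathcal{K}$ is the set of standard irreducible supermodular functions $f$ on $2^{[n]}$ such that $s_{I,J}=0$ for every close pair with $|I|=|J|\notin\{t,t+1\}$. Define $\alpha_{n,t}(I)=\max(0,|I|-t)$, $\alpha_{n,t+1}(I)=\max(0,|I|-t-1)$, and for $k\in[n]$, $\beta_{n,t,k}(I)=\max(0,|I\cap([n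]\setminus\{k\})|-t)$.
   Formalization: For n=3 (so t=1) the sets S with |S|=2=n−1 are excluded from the index set: there S={i,j} would map to β_{3,1,i}+β_{3,1,j}, which is reducible, so the claim as stated fails at n=3. For n≥4 nothing is changed. *)

theory Defs
  imports Complex_Main "HOL-Library.FuncSet"
begin

text \<open>
  The ground set is \<open>{1..n}\<close>.  A real function on its power set is a function
  \<open>nat set \<Rightarrow> real\<close> of which only the values on \<open>Pow {1..n}\<close> matter.  Where such functions
  are collected into a set they are taken to be \<open>undefined\<close> outside \<open>Pow {1..n}\<close>
  (\<open>extensional\<close>), so that equality in HOL is equality as functions on \<open>Pow {1..n}\<close>.
\<close>

definition supermodular :: "nat \<Rightarrow> (nat set \<Rightarrow> real) \<Rightarrow> bool" where
  "supermodular n f \<longleftrightarrow>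
     (\<forall>I \<in> Pow {1..n}. \<forall>J \<in> Pow {1..n}. f (I \<inter> J) + f (I \<union> J) \<ge> f I + f J)"

definition modular :: "nat \<Rightarrow> (nat set \<Rightarrow> real) \<Rightarrow> bool" where
  "modular n f \<longleftrightarrow>
     (\<forall>I \<in> Pow {1..n}. \<forall>J \<in> Pow {1..n}. f (I \<inter> J) + f (I \<union> J) = f I + f J)"

definition irreducible_supermodular :: "nat \<Rightarrow> (nat set \<Rightarrow> real) \<Rightarrow> bool" where
  "irreducible_supermodular n f \<longleftrightarrow>
     supermodular n f \<and> \<not> modular n f \<and>
     (\<forall>g1 g2. supermodular n g1 \<and> supermodular n g2 \<and>
        (\<forall>I \<in> Pow {1..n}. f I = g1 I + g2 I) \<longrightarrow>
        (\<exists>c1 \<ge> 0. modular n (\<lambda>I. g1 I - c1 * f I)) \<and>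
        (\<exists>c2 \<ge> 0. modular n (\<lambda>I. g2 I - c2 * f I)))"

definition standard_supermodular :: "nat \<Rightarrow> (nat set \<Rightarrow> real) \<Rightarrow> bool" where
  "standard_supermodular n f \<longleftrightarrow>
     supermodular n f \<and>
     (\<forall>I \<in> Pow {1..n}. card I \<le> 1 \<longrightarrow> f I = 0) \<and>
     (\<forall>I \<in> Pow {1..n}. f I \<in> \<nat>) \<and>
     Gcd {m :: nat. \<exists>I \<in> Pow {1..n}. f I = real m} = 1"

definition close_pair :: "nat set \<Rightarrow> nat set \<Rightarrow> bool" where
  "close_pair I J \<longleftrightarrow>
     card I = card J \<and> card I = card (I \<inter> J) + 1 \<and> int (card I) = int (card (I \<union> J)) - 1"

definition slack :: "(nat set \<Rightarrow> real) \<Rightarrow> nat set \<Rightarrow> nat set \<Rightarrow> real" where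
  "slack f I J = f (I \<inter> J) + f (I \<union> J) - f I - f J"

definition K_set :: "nat \<Rightarrow> nat \<Rightarrow> (nat set \<Rightarrow> real) set" where
  "K_set n t =
     {f \<in> extensional (Pow {1..n}).
        standard_supermodular n f \<and> irreducible_supermodular n f \<and>
        (\<forall>I \<in> Pow {1..n}. \<forall>J \<in> Pow {1..n}.
           close_pair I J \<and> card I \<notin> {t, t + 1} \<longrightarrow> slack f I J = 0)}"

definition alpha :: "nat \<Rightarrow> nat \<Rightarrow> nat set \<Rightarrow> real" where
  "alpha n t = (\<lambda>I \<in> Pow {1..n}. max 0 (real (card I) - real t))"

definition beta :: "nat \<Rightarrow> nat \<Rightarrow> nat \<Rightarrow> nat set \<Rightarrow> real" where
  "beta n t k = (\<lambda>I \<in> Pow {1..n}. max 0 (real (card (I \<inter> ({1..n} - {k}))) - real t))"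

end

theory Submission
  imports Defs
begin

text \<open>
  A function vanishing on sets of size at most 1 whose slacks vanish away from the levels \<open>t\<close> and
  \<open>t + 1\<close> is \<open>0\<close> on sets of size at most \<open>t\<close> and affine, \<open>I \<mapsto> a(I) - b\<close>, on larger sets; it is
  supermodular iff \<open>a(T) \<le> b \<le> a(U)\<close> whenever \<open>|T| = t\<close> and \<open>|U| = t + 1\<close>, and then equals
  \<open>max 0 (a(I) - b)\<close>.  So the problem is to find the extreme rays of this cone of pairs \<open>(a, b)\<close>.
  If \<open>a\<close> is constant, \<open>(a, b)\<close> is a combination of the two \<open>\<alpha>\<close>.  Otherwise let \<open>S\<close> be the set of
  minimal coordinates of \<open>a\<close>: the function attached to \<open>S\<close> takes two consecutive values as weights,
  and by an exchange argument a small multiple of it can be subtracted without leaving the cone,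
  so an extreme \<open>(a, b)\<close> is proportional to it.  Which \<open>S\<close> give extreme rays is read off from the
  tight constraints; the remaining ones split off \<open>{k}\<close> with \<open>k \<in> S\<close>, or \<open>[n] - {k}\<close> with \<open>k \<notin> S\<close>.
\<close>

section \<open>Ramps and general facts on modular, supermodular and standard functions\<close>

definition ramp :: "(nat \<Rightarrow> real) \<Rightarrow> real \<Rightarrow> nat set \<Rightarrow> real" where
  "ramp a b I = max 0 (sum a I - b)"

lemma ex_subset_card:
  assumes "m \<le> card A"
  shows "\<exists>T. T \<subseteq> A \<and> card T = m"
  using obtain_subset_with_card_n[OF assms] by blast

lemma ex_two_elems:
  assumes "2 \<le> card A"
  shows "\<exists>i j. i \<in> A \<and> j \<in> A \<and> i \<noteq> j"
  using ex_subset_card[OF assms] by (metis card_2_iff insert_subset)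

text \<open>Applying modularity to \<open>I\<close> and \<open>{x}\<close> adds one element at a
  time. For functions normalised to vanish on small sets, this turns equality up to a modular
  function into equality.\<close>

lemma modular_eq_0:
  assumes "modular n h" and small: "\<And>I. I \<subseteq> {1..n} \<Longrightarrow> card I \<le> 1 \<Longrightarrow> h I = 0"
    and "I \<subseteq> {1..n}"
  shows "h I = 0"
proof -
  have "finite I" using assms(3) finite_subset by blast
  then show ?thesis using assms(3)
  proof (induction I rule: finite_induct)
    case empty
    then show ?case using small by simp
  next
    case (insert x I)
    have "h (I \<inter> {x}) + h (I \<union> {x}) = h I + h {x}"
      using assms(1) insert.prems unfolding modular_def by blast
    moreover have "I \<inter> {x} = {}" using insert.hyps by blast
    ultimately show ?case using insert small[of "{}"] small[of "{x}"] by simp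
  qed
qed

lemma modular_affine: "modular n (\<lambda>I. c + sum w I)"
  unfolding modular_def
proof (intro ballI)
  fix I J assume "I \<in> Pow {1..n}" "J \<in> Pow {1..n}"
  then have "finite I" "finite J" using finite_subset by blast+
  then show "c + sum w (I \<inter> J) + (c + sum w (I \<union> J)) = c + sum w I + (c + sum w J)"
    using sum.union_inter[of I J w] by simp
qed

lemma modular_cong:
  assumes "modular n f" and "\<And>I. I \<subseteq> {1..n} \<Longrightarrow> f I = g I"
  shows "modular n g"
proof -
  have "g (I \<inter> J) + g (I \<union> J) = g I + g J" if "I \<subseteq> {1..n}" "J \<subseteq> {1..n}" for I J
  proof -
    have "f (I \<inter> J) + f (I \<union> J) = f I + f J" using assms(1) that unfolding modular_def by blast
    moreover have "I \<inter> J \<subseteq> {1..n}" "I \<union> J \<subseteq> {1..n}" using that by auto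
    ultimately show ?thesis using that by (simp only: assms(2))
  qed
  then show ?thesis unfolding modular_def by blast
qed

lemma supermodular_cong:
  assumes "supermodular n f" and "\<And>I. I \<subseteq> {1..n} \<Longrightarrow> f I = g I"
  shows "supermodular n g"
proof -
  have "g (I \<inter> J) + g (I \<union> J) \<ge> g I + g J" if "I \<subseteq> {1..n}" "J \<subseteq> {1..n}" for I J
  proof -
    have "f (I \<inter> J) + f (I \<union> J) \<ge> f I + f J" using assms(1) that unfolding supermodular_def by blast
    moreover have "I \<inter> J \<subseteq> {1..n}" "I \<union> J \<subseteq> {1..n}" using that by auto
    ultimately show ?thesis using that by (simp only: assms(2))
  qed
  then show ?thesis unfolding supermodular_def by blast
qed

lemma supermodular_scale:
  assumes "supermodular n f" "0 \<le> c"
  shows "supermodular n (\<lambda>I. c * f I)"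
  using assms unfolding supermodular_def by (simp add: mult_left_mono flip: distrib_left)

lemma irreducible_cong:
  assumes irr: "irreducible_supermodular n f" and eq: "\<And>I. I \<subseteq> {1..n} \<Longrightarrow> f I = g I"
  shows "irreducible_supermodular n g"
  unfolding irreducible_supermodular_def
proof (intro conjI allI impI)
  show "supermodular n g"
    using irr supermodular_cong[of n f g] eq unfolding irreducible_supermodular_def by blast
  show "\<not> modular n g"
    using irr modular_cong[of n g f] eq unfolding irreducible_supermodular_def by auto
  fix g1 g2
  assume "supermodular n g1 \<and> supermodular n g2 \<and> (\<forall>I \<in> Pow {1..n}. g I = g1 I + g2 I)"
  then have "supermodular n g1 \<and> supermodular n g2 \<and> (\<forall>I \<in> Pow {1..n}. f I = g1 I + g2 I)"
    using eq by simp
  then obtain c1 c2 where c: "c1 \<ge> 0" "modular n (\<lambda>I. g1 I - c1 * f I)"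
    "c2 \<ge> 0" "modular n (\<lambda>I. g2 I - c2 * f I)"
    using irr unfolding irreducible_supermodular_def by blast
  have "modular n (\<lambda>I. g1 I - c1 * g I)" "modular n (\<lambda>I. g2 I - c2 * g I)"
    by (rule modular_cong[OF c(2)] modular_cong[OF c(4)], simp add: eq)+
  then show "\<exists>c1\<ge>0. modular n (\<lambda>I. g1 I - c1 * g I)" "\<exists>c2\<ge>0. modular n (\<lambda>I. g2 I - c2 * g I)"
    using c by blast+
qed

text \<open>The sums over \<open>I\<close> and \<open>J\<close> lie between those over
  \<open>I \<inter> J\<close> and \<open>I \<union> J\<close> and have the same total, so convexity
  of \<open>max 0\<close> gives the inequality.\<close>

lemma supermodular_ramp:
  assumes "\<And>i. i \<in> {1..n} \<Longrightarrow> 0 \<le> a i"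
  shows "supermodular n (ramp a b)"
  unfolding supermodular_def
proof (intro ballI)
  fix I J assume IJ: "I \<in> Pow {1..n}" "J \<in> Pow {1..n}"
  then have fin: "finite I" "finite J" using finite_subset by blast+
  have "sum a (I \<union> J) + sum a (I \<inter> J) = sum a I + sum a J"
    using sum.union_inter[OF fin] .
  moreover have "sum a (I \<inter> J) \<le> sum a I" "sum a (I \<inter> J) \<le> sum a J"
    using assms IJ fin by (auto intro!: sum_mono2)
  ultimately show "ramp a b (I \<inter> J) + ramp a b (I \<union> J) \<ge> ramp a b I + ramp a b J"
    unfolding ramp_def by linarith
qed

lemma standard_not_all_0:
  assumes "standard_supermodular n f"
  obtains I where "I \<subseteq> {1..n}" "f I \<noteq> 0"
proof -
  have "Gcd {m :: nat. \<exists>I \<in> Pow {1..n}. f I = real m} = 1"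
    using assms unfolding standard_supermodular_def by blast
  \<comment> \<open>If all values were 0, the gcd would be that of a set containing at most 0, hence
    0 instead of 1.\<close>
  moreover have "Gcd {m :: nat. \<exists>I \<in> Pow {1..n}. f I = real m} = 0"
    if "\<forall>I \<subseteq> {1..n}. f I = 0"
    using that by (intro Gcd_0_iff[THEN iffD2]) auto
  ultimately show thesis using that by (metis zero_neq_one)
qed

lemma standard_not_modular:
  assumes "standard_supermodular n f"
  shows "\<not> modular n f"
proof
  assume m: "modular n f"
  obtain I where "I \<subseteq> {1..n}" "f I \<noteq> 0" using standard_not_all_0[OF assms] .
  then show False
    using modular_eq_0[OF m] assms unfolding standard_supermodular_def by auto
qed

text \<open>Proportionality is stated by cross multiplication, which avoids division. Fixing
  \<open>I\<close> and taking gcds over all \<open>J\<close> leaves \<open>f I = g I\<close>, since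
  both gcds are 1.\<close>

lemma standard_proportional_eq:
  assumes f: "standard_supermodular n f" and g: "standard_supermodular n g"
    and cross: "\<And>I J. I \<subseteq> {1..n} \<Longrightarrow> J \<subseteq> {1..n} \<Longrightarrow> f I * g J = f J * g I"
    and I: "I \<subseteq> {1..n}"
  shows "f I = g I"
proof -
  define u where "u J = (THE m :: nat. f J = real m)" for J
  define v where "v J = (THE m :: nat. g J = real m)" for J
  have u: "f J = real (u J)" if "J \<subseteq> {1..n}" for J
  proof -
    have "f J \<in> \<nat>" using f that unfolding standard_supermodular_def by blast
    then obtain m where "f J = real m" by (auto elim: Nats_cases)
    then show ?thesis unfolding u_def by simp
  qed
  have v: "g J = real (v J)" if "J \<subseteq> {1..n}" for J
  proof -
    have "g J \<in> \<nat>" using g that unfolding standard_supermodular_def by blast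
    then obtain m where "g J = real m" by (auto elim: Nats_cases)
    then show ?thesis unfolding v_def by simp
  qed
  have "{m :: nat. \<exists>I \<in> Pow {1..n}. f I = real m} = u ` Pow {1..n}" using u by force
  then have gu: "Gcd (u ` Pow {1..n}) = 1"
    using f unfolding standard_supermodular_def by simp
  have "{m :: nat. \<exists>I \<in> Pow {1..n}. g I = real m} = v ` Pow {1..n}" using v by force
  then have gv: "Gcd (v ` Pow {1..n}) = 1"
    using g unfolding standard_supermodular_def by simp
  have "u I * v J = v I * u J" if "J \<subseteq> {1..n}" for J
  proof -
    have "real (u I * v J) = real (v I * u J)" using cross[OF I that] u v I that by simp
    then show ?thesis by linarith
  qed
  then have "(*) (u I) ` (v ` Pow {1..n}) = (*) (v I) ` (u ` Pow {1..n})"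
    unfolding image_image by (intro image_cong) auto
  then have "u I * Gcd (v ` Pow {1..n}) = v I * Gcd (u ` Pow {1..n})"
    using Gcd_mult[of "u I" "v ` Pow {1..n}"] Gcd_mult[of "v I" "u ` Pow {1..n}"] by simp
  then show ?thesis using gu gv u v I by simp
qed

text \<open>Irreducibility makes \<open>e * g\<close> differ from a multiple of \<open>f\<close> by
  a modular function. That function vanishes on small sets, hence everywhere, so \<open>f\<close>
  and \<open>g\<close> are proportional and standardness fixes the factor. This is how an
  irreducible function is identified from any standard summand.\<close>

lemma irreducible_eq_standard_summand:
  assumes irr: "irreducible_supermodular n f"
    and f: "standard_supermodular n f" and g: "standard_supermodular n g"
    and "0 < e" and sup: "supermodular n (\<lambda>I. f I - e * g I)"
    and I: "I \<subseteq> {1..n}"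
  shows "f I = g I"
proof -
  have "supermodular n g" using g unfolding standard_supermodular_def by blast
  then have eg: "supermodular n (\<lambda>I. e * g I)"
    using supermodular_scale \<open>0 < e\<close> by simp
  have "\<exists>c\<ge>0. modular n (\<lambda>I. g2 I - c * f I)"
    if "supermodular n g1" "supermodular n g2" "\<forall>I \<in> Pow {1..n}. f I = g1 I + g2 I" for g1 g2
    using irr that unfolding irreducible_supermodular_def by blast
  from this[OF sup eg] obtain c where c: "c \<ge> 0" "modular n (\<lambda>I. e * g I - c * f I)"
    by auto
  have eq: "e * g J = c * f J" if "J \<subseteq> {1..n}" for J
    using modular_eq_0[OF c(2) _ that] f g unfolding standard_supermodular_def by auto
  obtain J where J: "J \<subseteq> {1..n}" "g J \<noteq> 0" using standard_not_all_0[OF g] .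
  with eq[OF J(1)] \<open>0 < e\<close> have "c \<noteq> 0" by auto
  then have "f J = e / c * g J" if "J \<subseteq> {1..n}" for J using eq[OF that] by (simp add: field_simps)
  then show ?thesis using standard_proportional_eq[OF f g _ I] by (simp add: mult_ac)
qed

text \<open>Each constraint with \<open>u x > 0\<close> tolerates some positive multiple of
  \<open>w x\<close>, and those with \<open>u x = 0\<close> tolerate every one; finiteness allows
  the minimum to be taken.\<close>

lemma uniform_scaling:
  fixes u w :: "'a \<Rightarrow> real"
  assumes "finite A" and "\<And>x. x \<in> A \<Longrightarrow> 0 \<le> u x" and "\<And>x. x \<in> A \<Longrightarrow> u x = 0 \<Longrightarrow> w x \<le> 0"
  shows "\<exists>e>0. \<forall>x\<in>A. e * w x \<le> u x"
  using assms
proof (induction A rule: finite_induct)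
  case empty
  show ?case by (intro exI[of _ 1]) simp
next
  case (insert x A)
  then obtain e where e: "e > 0" "\<forall>x\<in>A. e * w x \<le> u x" by auto
  obtain d where d: "d > 0" "d * w x \<le> u x"
  proof (cases "w x \<le> 0")
    case True
    with that[of 1] insert.prems(1)[of x] show thesis by simp
  next
    case False
    with insert.prems have "u x > 0" by (metis insertI1 order_le_less)
    with that[of "u x / w x"] False show thesis by simp
  qed
  \<comment> \<open>Decreasing the multiplier is harmless: for \<open>w y \<le> 0\<close> the left
    side is nonpositive, otherwise it decreases.\<close>
  have *: "min d e * w y \<le> u y" if "c * w y \<le> u y" "min d e \<le> c" "0 \<le> u y" for y c
  proof (cases "w y \<le> 0")
    case True
    then have "min d e * w y \<le> 0" using d(1) e(1) by (simp add: mult_le_0_iff)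
    with that show ?thesis by linarith
  next
    case False
    then have "min d e * w y \<le> c * w y" using that by (intro mult_right_mono) auto
    with that show ?thesis by linarith
  qed
  show ?case
    using d e insert.prems(1) by (intro exI[of _ "min d e"]) (auto intro: *[of d] *[of e])
qed

section \<open>The cone of pairs \<open>(a, b)\<close> and their ramps\<close>

locale two_levels =
  fixes n t :: nat
  assumes t_ge: "1 \<le> t" and t_le: "t + 2 \<le> n"
begin

abbreviation N :: "nat set" where "N \<equiv> {1..n}"

definition cone :: "(nat \<Rightarrow> real) \<Rightarrow> real \<Rightarrow> bool" where
  "cone a b \<longleftrightarrow> (\<forall>T \<subseteq> N. card T = t \<longrightarrow> sum a T \<le> b) \<and> (\<forall>U \<subseteq> N. card U = t + 1 \<longrightarrow> b \<le> sum a U)"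

lemma finN: "I \<subseteq> N \<Longrightarrow> finite I"
  using finite_subset by blast

text \<open>Compare a \<open>t\<close>-set avoiding \<open>i\<close> with the
  \<open>(t + 1)\<close>-set obtained by adding \<open>i\<close>: \<open>b\<close> lies between the
  two sums.\<close>

lemma cone_nonneg:
  assumes "cone a b" "i \<in> N"
  shows "0 \<le> a i"
proof -
  have "t \<le> card (N - {i})" using t_le assms(2) by simp
  then obtain T where T: "T \<subseteq> N - {i}" "card T = t" by (meson obtain_subset_with_card_n)
  then have "finite T" using finN[of T] by blast
  have "i \<notin> T" "T \<subseteq> N" "insert i T \<subseteq> N" using T assms by auto
  moreover have "card (insert i T) = t + 1" using T \<open>finite T\<close> \<open>i \<notin> T\<close> by simp
  ultimately have "sum a T \<le> b" "b \<le> sum a (insert i T)"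
    using assms(1) T unfolding cone_def by auto
  then show ?thesis using \<open>finite T\<close> \<open>i \<notin> T\<close> by simp
qed

lemma cone_sum_le:
  assumes "cone a b" "I \<subseteq> N" "card I \<le> t"
  shows "sum a I \<le> b"
proof -
  have "t \<le> card N" using t_le by simp
  then obtain T where T: "I \<subseteq> T" "T \<subseteq> N" "card T = t"
    using exists_subset_between[of I t N] assms by auto
  then have "sum a I \<le> sum a T"
    using cone_nonneg[OF assms(1)] finN by (intro sum_mono2) auto
  also have "\<dots> \<le> b" using assms(1) T unfolding cone_def by blast
  finally show ?thesis .
qed

lemma cone_sum_ge:
  assumes "cone a b" "I \<subseteq> N" "t < card I"
  shows "b \<le> sum a I"
proof -
  obtain T where T: "T \<subseteq> I" "card T = t + 1"
    using ex_subset_card[of "t + 1" I] assms by auto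
  then have "b \<le> sum a T" using assms(1,2) unfolding cone_def by blast
  also have "\<dots> \<le> sum a I"
    using cone_nonneg[OF assms(1)] finN assms T by (intro sum_mono2) auto
  finally show ?thesis .
qed

text \<open>On the cone the maximum switches at size \<open>t\<close> whatever \<open>(a, b)\<close>
  is. Hence ramps are additive in the pair there, although \<open>max\<close> is not linear.\<close>

lemma ramp_eq:
  assumes "cone a b" "I \<subseteq> N"
  shows "ramp a b I = (if card I \<le> t then 0 else sum a I - b)"
  using cone_sum_le[OF assms] cone_sum_ge[OF assms] unfolding ramp_def by auto

lemma supermodular_cone: "cone a b \<Longrightarrow> supermodular n (ramp a b)"
  using supermodular_ramp cone_nonneg by blast

lemma cone_add: "cone a b \<Longrightarrow> cone a' b' \<Longrightarrow> cone (\<lambda>i. a i + a' i) (b + b')"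
  unfolding cone_def sum.distrib by (intro conjI allI impI add_mono) blast+

lemma ramp_add:
  assumes "cone a b" "cone a' b'" "I \<subseteq> N"
  shows "ramp (\<lambda>i. a i + a' i) (b + b') I = ramp a b I + ramp a' b' I"
  using ramp_eq[OF cone_add[OF assms(1,2)] assms(3)] ramp_eq[OF assms(1,3)] ramp_eq[OF assms(2,3)]
  by (simp add: sum.distrib)

lemma ramp_scale: "0 \<le> c \<Longrightarrow> ramp (\<lambda>i. c * a i) (c * b) I = c * ramp a b I"
  unfolding ramp_def by (simp add: max_mult_distrib_left flip: sum_distrib_left right_diff_distrib)

lemma ramp_cong:
  assumes "\<And>i. i \<in> N \<Longrightarrow> a i = a' i" "I \<subseteq> N"
  shows "ramp a b I = ramp a' b I"
proof -
  have "sum a I = sum a' I" using assms by (intro sum.cong) auto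
  then show ?thesis unfolding ramp_def by simp
qed

lemma ramp_N: "cone a b \<Longrightarrow> ramp a b N = sum a N - b"
  using ramp_eq[of a b N] t_le by simp

lemma ramp_N_minus:
  assumes "cone a b" "i \<in> N"
  shows "ramp a b (N - {i}) = sum a N - a i - b"
  using ramp_eq[OF assms(1), of "N - {i}"] assms(2) t_le by (auto simp: sum_diff1)

text \<open>The values at \<open>N\<close> and \<open>N - {i}\<close> already determine the pair;
  both sets have more than \<open>t\<close> elements because \<open>t + 2 \<le> n\<close>.\<close>

lemma ramp_inject:
  assumes "cone a b" "cone a' b'" and eq: "\<And>I. I \<subseteq> N \<Longrightarrow> ramp a b I = ramp a' b' I"
  shows "\<forall>i\<in>N. a i = a' i" and "b = b'"
proof -
  show *: "\<forall>i\<in>N. a i = a' i"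
  proof
    fix i assume i: "i \<in> N"
    show "a i = a' i"
      using eq[of N] eq[of "N - {i}"] ramp_N[OF assms(1)] ramp_N[OF assms(2)]
        ramp_N_minus[OF assms(1) i] ramp_N_minus[OF assms(2) i] by simp
  qed
  then have "sum a N = sum a' N" by (intro sum.cong) auto
  then show "b = b'"
    using eq[of N] ramp_N[OF assms(1)] ramp_N[OF assms(2)] by simp
qed

section \<open>Functions whose slacks vanish away from the two levels are ramps\<close>

definition flat :: "(nat set \<Rightarrow> real) \<Rightarrow> bool" where
  "flat f \<longleftrightarrow> (\<forall>I \<in> Pow N. \<forall>J \<in> Pow N.
     close_pair I J \<and> card I \<notin> {t, t + 1} \<longrightarrow> slack f I J = 0)"

text \<open>If \<open>card I < t\<close>, all four sets of the slack lie where the ramp is 0; if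
  \<open>card I > t + 1\<close>, even the intersection lies where it is affine.\<close>

lemma flat_ramp:
  assumes "cone a b"
  shows "flat (ramp a b)"
  unfolding flat_def
proof (intro ballI impI)
  fix I J assume "I \<in> Pow N" "J \<in> Pow N" and c: "close_pair I J \<and> card I \<notin> {t, t + 1}"
  then have sub: "I \<subseteq> N" "J \<subseteq> N" "I \<inter> J \<subseteq> N" "I \<union> J \<subseteq> N" by auto
  have cards: "card J = card I" "card I = card (I \<inter> J) + 1" "card (I \<union> J) = card I + 1"
    using c unfolding close_pair_def by auto
  have "sum a (I \<union> J) + sum a (I \<inter> J) = sum a I + sum a J"
    using sum.union_inter finN sub by blast
  moreover have "card I < t \<or> t + 1 < card I" using c by auto
  ultimately show "slack (ramp a b) I J = 0"
    using cards ramp_eq[OF assms sub(1)] ramp_eq[OF assms sub(2)] ramp_eq[OF assms sub(3)]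
      ramp_eq[OF assms sub(4)] unfolding slack_def by auto
qed

lemma close_pair_insert:
  assumes "B \<subseteq> N" "i \<notin> B" "j \<notin> B" "i \<noteq> j"
  shows "close_pair (insert i B) (insert j B)"
    and "insert i B \<inter> insert j B = B" and "insert i B \<union> insert j B = insert i (insert j B)"
    and "card (insert i B) = card B + 1"
proof -
  have "finite B" using assms finN by blast
  moreover show 1: "insert i B \<inter> insert j B = B" "insert i B \<union> insert j B = insert i (insert j B)"
    using assms by auto
  ultimately show "close_pair (insert i B) (insert j B)" "card (insert i B) = card B + 1"
    unfolding close_pair_def 1 using assms by auto
qed

text \<open>A set of size between 2 and \<open>t\<close> is the union of a close pair of level below
  \<open>t\<close>, so the zero slack expresses its value through smaller sets.\<close>

lemma flat_vanishes:
  assumes "flat f" and "\<And>I. I \<subseteq> N \<Longrightarrow> card I \<le> 1 \<Longrightarrow> f I = 0"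
  shows "I \<subseteq> N \<Longrightarrow> card I \<le> t \<Longrightarrow> f I = 0"
proof (induction "card I" arbitrary: I rule: less_induct)
  case less
  show ?case
  proof (cases "card I \<le> 1")
    case True
    then show ?thesis using assms(2) less.prems by blast
  next
    case False
    then have "2 \<le> card I" by simp
    then obtain i j where ij: "i \<in> I" "j \<in> I" "i \<noteq> j"
      using ex_two_elems by blast
    define B where "B = I - {i, j}"
    have B: "B \<subseteq> N" "i \<notin> B" "j \<notin> B" "I = insert i (insert j B)" "finite B"
      using ij less.prems finN unfolding B_def by auto
    have "card I = card B + 2" using B ij by simp
    note cp = close_pair_insert[OF B(1-3) ij(3)]
    have "slack f (insert i B) (insert j B) = 0"
      using assms(1) cp(1,4) B ij less.prems \<open>card I = card B + 2\<close>
      unfolding flat_def by auto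
    moreover have "f B = 0" "f (insert i B) = 0" "f (insert j B) = 0"
      using less.hyps[of B] less.hyps[of "insert i B"] less.hyps[of "insert j B"]
        less.prems B \<open>card I = card B + 2\<close> by auto
    ultimately show ?thesis using B unfolding slack_def cp by simp
  qed
qed

text \<open>The dual induction, downwards from \<open>N\<close>: for \<open>card A \<ge> 2\<close>
  the set \<open>N - A\<close> is the intersection of a close pair, and the bound on
  \<open>card A\<close> puts that pair above level \<open>t + 1\<close>.\<close>

lemma flat_affine:
  assumes "flat f"
  shows "A \<subseteq> N \<Longrightarrow> card A + t + 1 \<le> n \<Longrightarrow> f (N - A) = f N - (\<Sum>i\<in>A. f N - f (N - {i}))"
proof (induction "card A" arbitrary: A rule: less_induct)
  case less
  have "finite A" using less.prems finN by blast
  show ?case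
  proof (cases "card A \<le> 1")
    case True
    then consider "A = {}" | i where "A = {i}"
      using \<open>finite A\<close> by (metis card_0_eq card_1_singletonE le_SucE le_zero_eq One_nat_def)
    then show ?thesis by cases auto
  next
    case False
    then have "2 \<le> card A" by simp
    then obtain i j where ij: "i \<in> A" "j \<in> A" "i \<noteq> j"
      using ex_two_elems by blast
    define B where "B = A - {i, j}"
    have B: "B \<subseteq> N" "i \<notin> B" "j \<notin> B" "A = insert i (insert j B)" "finite B"
      using ij less.prems finN unfolding B_def by auto
    have cA: "card A = card B + 2" using B ij by simp
    have cN: "card (N - A) = n - card A" using less.prems by (simp add: card_Diff_subset \<open>finite A\<close>)
    have "i \<notin> N - A" "j \<notin> N - A" "N - A \<subseteq> N" using ij by auto
    note cp = close_pair_insert[OF this(3,1,2) ij(3)]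
    have eqs: "insert i (N - A) = N - insert j B" "insert j (N - A) = N - insert i B"
      "insert i (insert j (N - A)) = N - B"
      using ij B less.prems by auto
    have "slack f (insert i (N - A)) (insert j (N - A)) = 0"
    proof -
      have "insert i (N - A) \<in> Pow N" "insert j (N - A) \<in> Pow N" using ij less.prems by auto
      moreover have "card (insert i (N - A)) \<notin> {t, t + 1}" unfolding cp(4) cN using less.prems by auto
      ultimately show ?thesis using assms cp(1) unfolding flat_def by blast
    qed
    then have "f (N - A) + f (N - B) = f (N - insert j B) + f (N - insert i B)"
      unfolding slack_def cp(2,3) unfolding eqs(3) unfolding eqs(1,2) by simp
    moreover have "f (N - B) = f N - (\<Sum>i\<in>B. f N - f (N - {i}))"
      "f (N - insert i B) = f N - (\<Sum>i\<in>insert i B. f N - f (N - {i}))"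
      "f (N - insert j B) = f N - (\<Sum>i\<in>insert j B. f N - f (N - {i}))"
      using less.hyps[of B] less.hyps[of "insert i B"] less.hyps[of "insert j B"]
        less.prems B cA by auto
    ultimately show ?thesis
      using B ij by simp
  qed
qed

lemma flat_supermodular_ramp:
  assumes fl: "flat f" and z: "\<And>I. I \<subseteq> N \<Longrightarrow> card I \<le> 1 \<Longrightarrow> f I = 0" and sup: "supermodular n f"
  obtains a b where "cone a b" "\<And>I. I \<subseteq> N \<Longrightarrow> f I = ramp a b I"
proof -
  \<comment> \<open>The weights are the marginal values at the top of the lattice, and
    \<open>b\<close> is fitted at \<open>N\<close>.\<close>
  define a where "a i = f N - f (N - {i})" for i
  define b where "b = sum a N - f N"
  have low: "f I = 0" if "I \<subseteq> N" "card I \<le> t" for I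
    using flat_vanishes[OF fl z that] .
  have high: "f I = sum a I - b" if "I \<subseteq> N" "t < card I" for I
  proof -
    have "card (N - I) = n - card I" using that finN by (simp add: card_Diff_subset)
    moreover have "card I \<le> n" using that card_mono[of N I] by simp
    ultimately have "f (N - (N - I)) = f N - sum a (N - I)"
      unfolding a_def using that by (intro flat_affine[OF fl]) auto
    moreover have "N - (N - I) = I" using that by blast
    moreover have "sum a (N - I) = sum a N - sum a I" using that by (simp add: sum_diff)
    ultimately show ?thesis unfolding b_def by simp
  qed
  have sup2: "f B + f (insert i (insert j B)) \<ge> f (insert i B) + f (insert j B)"
    if "insert i (insert j B) \<subseteq> N" "i \<notin> B" "j \<notin> B" "i \<noteq> j" for i j B
  proof -
    have "f (insert i B \<inter> insert j B) + f (insert i B \<union> insert j B) \<ge> f (insert i B) + f (insert j B)"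
      using sup that unfolding supermodular_def by blast
    moreover have "B \<subseteq> N" using that by blast
    ultimately show ?thesis using close_pair_insert(2,3)[of B i j] that by simp
  qed
  have c: "cone a b"
    unfolding cone_def
  proof (intro conjI allI impI)
    fix T assume T: "T \<subseteq> N" "card T = t"
    then have "finite T" using finN by blast
    have "2 \<le> card (N - T)" using T t_le \<open>finite T\<close> by (simp add: card_Diff_subset)
    then obtain i j where ij: "i \<in> N - T" "j \<in> N - T" "i \<noteq> j"
      using ex_two_elems by blast
    have sub: "insert i T \<subseteq> N" "insert j T \<subseteq> N" "insert i (insert j T) \<subseteq> N"
      using T ij by auto
    have "card (insert i T) = t + 1" "card (insert j T) = t + 1" "card (insert i (insert j T)) = t + 2"
      using T ij \<open>finite T\<close> by auto
    then have "f T = 0" "f (insert i T) = sum a (insert i T) - b" "f (insert j T) = sum a (insert j T) - b"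
      "f (insert i (insert j T)) = sum a (insert i (insert j T)) - b"
      using low[of T] high[OF sub(1)] high[OF sub(2)] high[OF sub(3)] T by simp_all
    \<comment> \<open>The slack of the pair of level \<open>t + 1\<close> with intersection
      \<open>T\<close> equals \<open>b - sum a T\<close>.\<close>
    with sup2[of i j T] show "sum a T \<le> b" using ij T \<open>finite T\<close> by simp
  next
    fix U assume U: "U \<subseteq> N" "card U = t + 1"
    then have "2 \<le> card U" using t_ge by simp
    then obtain i j where ij: "i \<in> U" "j \<in> U" "i \<noteq> j"
      using ex_two_elems by blast
    define B where "B = U - {i, j}"
    have B: "B \<subseteq> N" "i \<notin> B" "j \<notin> B" "U = insert i (insert j B)" "finite B"
      using ij U finN unfolding B_def by auto
    have "card U = card B + 2" using B ij by simp
    then have "f B = 0" "f (insert i B) = 0" "f (insert j B) = 0" "f U = sum a U - b"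
      using U B by (auto intro!: low high)
    \<comment> \<open>Here the pair has level \<open>t\<close> and union \<open>U\<close>; the other
      three values vanish, so its slack is \<open>sum a U - b\<close>.\<close>
    with sup2[of i j B] B ij U show "b \<le> sum a U" by simp
  qed
  have "f I = ramp a b I" if "I \<subseteq> N" for I
    using ramp_eq[OF c that] low[OF that] high[OF that] by (cases "card I \<le> t") auto
  with c show thesis by (rule that)
qed

section \<open>The candidate rays attached to subsets \<open>S\<close>\<close>

text \<open>
  A set of size \<open>t\<close> has at most \<open>top_off S\<close> elements outside \<open>S\<close> and a set of size \<open>t + 1\<close> at least
  \<open>bot_off S\<close>.  Hence \<open>height S\<close> is the value for which the largest sum of \<open>weight S\<close> over a
  \<open>t\<close>-set equals the smallest one over a \<open>(t + 1)\<close>-set, both being \<open>offset S\<close>.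
\<close>

definition top_off :: "nat set \<Rightarrow> nat" where
  "top_off S = min t (n - card S)"

definition bot_off :: "nat set \<Rightarrow> nat" where
  "bot_off S = t + 1 - card S"

definition height :: "nat set \<Rightarrow> real" where
  "height S = real (top_off S) - real (bot_off S)"

definition weight :: "nat set \<Rightarrow> nat \<Rightarrow> real" where
  "weight S i = height S + (if i \<in> S then 0 else 1)"

definition offset :: "nat set \<Rightarrow> real" where
  "offset S = real t * height S + real (top_off S)"

abbreviation proper :: "nat set \<Rightarrow> bool" where
  "proper S \<equiv> S \<subset> N \<and> S \<noteq> {}"

lemma proper_card: "proper S \<Longrightarrow> 1 \<le> card S \<and> card S + 1 \<le> n"
  using psubset_card_mono[of N S] finN[of S] by (auto simp: Suc_le_eq card_gt_0_iff)

lemma bot_le_top: "proper S \<Longrightarrow> bot_off S \<le> top_off S"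
  using proper_card[of S] t_le unfolding bot_off_def top_off_def by auto

lemma height_nonneg: "proper S \<Longrightarrow> 0 \<le> height S"
  using bot_le_top unfolding height_def by simp

lemma sum_weight:
  assumes "I \<subseteq> N"
  shows "sum (weight S) I = real (card I) * height S + real (card (I - S))"
proof -
  have "finite I" using assms finN by blast
  then have "(\<Sum>i\<in>I. if i \<in> S then 0 else 1 :: real) = real (card (I - S))"
    by (simp add: sum.If_cases set_diff_eq Int_def)
  then show ?thesis unfolding weight_def by (simp add: sum.distrib)
qed

lemma card_diff_le: "T \<subseteq> N \<Longrightarrow> S \<subseteq> N \<Longrightarrow> card (T - S) \<le> min (card T) (n - card S)"
  using card_mono[of T "T - S"] card_mono[of "N - S" "T - S"] finN[of T] finN[of S]
  by (auto simp: card_Diff_subset)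

lemma card_diff_ge: "U \<subseteq> N \<Longrightarrow> S \<subseteq> N \<Longrightarrow> card U - card S \<le> card (U - S)"
  using diff_card_le_card_Diff[of S U] finN[of S] by simp

lemma sum_weight_top: "T \<subseteq> N \<Longrightarrow> card T = t \<Longrightarrow> card (T - S) = top_off S \<Longrightarrow> sum (weight S) T = offset S"
  by (simp add: sum_weight offset_def)

lemma sum_weight_bot: "U \<subseteq> N \<Longrightarrow> card U = t + 1 \<Longrightarrow> card (U - S) = bot_off S \<Longrightarrow> sum (weight S) U = offset S"
  by (simp add: sum_weight offset_def height_def algebra_simps)

lemma cone_weight:
  assumes "S \<subseteq> N"
  shows "cone (weight S) (offset S)"
  unfolding cone_def
proof (intro conjI allI impI)
  fix T assume T: "T \<subseteq> N" "card T = t"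
  have "card (T - S) \<le> top_off S"
    using card_diff_le[OF T(1) assms] T unfolding top_off_def by simp
  then show "sum (weight S) T \<le> offset S" using T by (simp add: sum_weight offset_def)
next
  fix U assume U: "U \<subseteq> N" "card U = t + 1"
  have "bot_off S \<le> card (U - S)"
    using card_diff_ge[OF U(1) assms] U unfolding bot_off_def by simp
  then show "offset S \<le> sum (weight S) U" using U by (simp add: sum_weight offset_def height_def algebra_simps)
qed

definition ray :: "nat set \<Rightarrow> nat set \<Rightarrow> real" where
  "ray S = ramp (weight S) (offset S)"

text \<open>Every weight is a difference of two values of the ray, at \<open>N\<close> and
  \<open>N - {i}\<close>. A proper \<open>S\<close> realises both \<open>height S\<close> and
  \<open>height S + 1\<close>, so a common divisor of the values divides 1.\<close>

lemma standard_ray: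
  assumes "proper S"
  shows "standard_supermodular n (ray S)"
proof -
  have c: "cone (weight S) (offset S)" using cone_weight assms by blast
  have nat: "\<exists>m :: nat. ray S I = real m" if "I \<subseteq> N" for I
  proof -
    define z :: int where "z = int (card I) * (int (top_off S) - int (bot_off S)) + int (card (I - S))
      - (int t * (int (top_off S) - int (bot_off S)) + int (top_off S))"
    have "ray S I = max 0 (real_of_int z)"
      unfolding ray_def ramp_def sum_weight[OF that] offset_def height_def z_def by simp
    also have "\<dots> = real (nat z)" by simp
    finally show ?thesis by blast
  qed
  define V where "V = {m :: nat. \<exists>I \<in> Pow N. ray S I = real m}"
  define d where "d = Gcd V"
  have dv: "int d dvd z" if "I \<subseteq> N" "ray S I = real_of_int z" for I z
  proof -
    obtain m where m: "ray S I = real m" using nat[OF \<open>I \<subseteq> N\<close>] by blast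
    then have "m \<in> V" using that unfolding V_def by blast
    then have "d dvd m" unfolding d_def by (rule Gcd_dvd)
    moreover have "z = int m" using m that by linarith
    ultimately show ?thesis by simp
  qed
  have diff: "int d dvd z" if i: "i \<in> N" "weight S i = real_of_int z" for i z
  proof -
    obtain m1 where m1: "ray S N = real m1" using nat by blast
    obtain m2 where m2: "ray S (N - {i}) = real m2" using nat by blast
    have "int d dvd int m1" "int d dvd int m2" using dv[of N "int m1"] dv[of "N - {i}" "int m2"] m1 m2 by auto
    moreover have "weight S i = ray S N - ray S (N - {i})"
      unfolding ray_def using ramp_N[OF c] ramp_N_minus[OF c i(1)] by simp
    then have "real_of_int z = real_of_int (int m1 - int m2)" using m1 m2 i by simp
    then have "z = int m1 - int m2" by linarith
    ultimately show ?thesis by simp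
  qed
  obtain i j where "i \<in> S" "j \<in> N" "j \<notin> S" using assms by blast
  define h where "h = int (top_off S) - int (bot_off S)"
  have "int d dvd h" using diff[of i h] \<open>i \<in> S\<close> assms by (auto simp: weight_def height_def h_def)
  moreover have "int d dvd h + 1"
    using diff[of j "h + 1"] \<open>j \<in> N\<close> \<open>j \<notin> S\<close> by (auto simp: weight_def height_def h_def)
  ultimately have "int d dvd 1" by (metis dvd_add_right_iff)
  then have "d = 1" by simp
  moreover have "ray S I = 0" if "I \<subseteq> N" "card I \<le> 1" for I
    using that ramp_eq[OF c] t_ge unfolding ray_def by simp
  moreover have "ray S I \<in> \<nat>" if "I \<subseteq> N" for I using nat[OF that] by auto
  ultimately show ?thesis
    using supermodular_cone[OF c] unfolding standard_supermodular_def d_def V_def ray_def by auto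
qed

lemma standard_alpha:
  assumes "u + 1 \<le> n" "1 \<le> u"
  shows "standard_supermodular n (alpha n u)"
proof -
  have "supermodular n (ramp (\<lambda>i. 1) (real u))" by (rule supermodular_ramp) simp
  then have "supermodular n (alpha n u)"
    by (rule supermodular_cong) (simp add: ramp_def alpha_def)
  moreover obtain T where T: "T \<subseteq> N" "card T = u + 1"
    using ex_subset_card[of "u + 1" N] assms by auto
  \<comment> \<open>The value at a set of size \<open>u + 1\<close> is 1.\<close>
  have "Gcd {m :: nat. \<exists>I \<in> Pow N. alpha n u I = real m} dvd 1"
    using T by (intro Gcd_dvd) (auto simp: alpha_def intro!: bexI[of _ T])
  moreover have "alpha n u I = real (card I - u)" if "I \<subseteq> N" for I
    using that by (simp add: alpha_def)
  ultimately show ?thesis using assms unfolding standard_supermodular_def by auto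
qed

text \<open>The ray determines the weights, and a proper set is recovered from its weight as the set
  of points where the maximum is not attained.\<close>

lemma ray_inject:
  assumes "proper S" "proper S'" "\<And>I. I \<subseteq> N \<Longrightarrow> ray S I = ray S' I"
  shows "S = S'"
proof -
  have c: "cone (weight S) (offset S)" "cone (weight S') (offset S')" using cone_weight assms by blast+
  have eq: "\<forall>i\<in>N. weight S i = weight S' i"
    using ramp_inject(1)[OF c] assms(3) unfolding ray_def by blast
  have char: "R = {i \<in> N. \<exists>j\<in>N. weight R i < weight R j}" if "proper R" for R
    using that unfolding weight_def by auto
  have "{i \<in> N. \<exists>j\<in>N. weight S i < weight S j} = {i \<in> N. \<exists>j\<in>N. weight S' i < weight S' j}"
    using eq by auto
  then show ?thesis using char[OF assms(1)] char[OF assms(2)] by simp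
qed

section \<open>Subtracting a multiple of a ray inside the cone\<close>

text \<open>
  Exchange argument: replacing an element of the minimum set \<open>S\<close> by one outside it strictly
  increases the sum, so every constraint that is tight at \<open>(a, b)\<close> is tight at \<open>weight S\<close>.
\<close>

lemma tight_top:
  assumes "cone a b" and S: "S = {i \<in> N. a i = v}" and v: "\<And>i. i \<in> N \<Longrightarrow> v \<le> a i"
    and T: "T \<subseteq> N" "card T = t" "sum a T = b"
  shows "card (T - S) = top_off S"
proof (rule ccontr)
  assume neq: "card (T - S) \<noteq> top_off S"
  have SN: "S \<subseteq> N" using S by blast
  have fin: "finite T" "finite S" using T SN finN by blast+
  \<comment> \<open>Both bounds in \<open>top_off S\<close> are missed: the first leaves an element
    of \<open>S\<close> in \<open>T\<close> to remove, the second an element outside both to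
    add.\<close>
  have lt: "card (T - S) < t" "card (T - S) < n - card S"
    using card_diff_le[OF T(1) SN] neq T unfolding top_off_def by auto
  then have "T \<inter> S \<noteq> {}" using T by (metis Diff_triv less_irrefl)
  then obtain j where j: "j \<in> T" "j \<in> S" by blast
  have "card (N - S) = n - card S" using SN fin by (simp add: card_Diff_subset)
  then have "\<not> N - S \<subseteq> T - S" using lt card_mono[of "T - S" "N - S"] fin by auto
  then obtain i where i: "i \<in> N" "i \<notin> S" "i \<notin> T" by blast
  have "card (insert i (T - {j})) = t" using T i j fin t_ge by simp
  moreover have "insert i (T - {j}) \<subseteq> N" using T i by blast
  ultimately have "sum a (insert i (T - {j})) \<le> b" using assms(1) unfolding cone_def by blast
  then have "a i \<le> a j" using T i j fin by (simp add: sum_diff1)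
  moreover have "a j = v" "v \<le> a i" "a i \<noteq> v" using i j v S by auto
  ultimately show False by simp
qed

lemma tight_bot:
  assumes "cone a b" and S: "S = {i \<in> N. a i = v}" and v: "\<And>i. i \<in> N \<Longrightarrow> v \<le> a i"
    and U: "U \<subseteq> N" "card U = t + 1" "sum a U = b"
  shows "card (U - S) = bot_off S"
proof (rule ccontr)
  assume neq: "card (U - S) \<noteq> bot_off S"
  have SN: "S \<subseteq> N" using S by blast
  have fin: "finite U" "finite S" using U SN finN by blast+
  \<comment> \<open>Dually, \<open>U\<close> has an element outside \<open>S\<close> to remove, and
    \<open>S\<close> has one outside \<open>U\<close> to add.\<close>
  have lt: "0 < card (U - S)" "t + 1 < card (U - S) + card S"
    using card_diff_ge[OF U(1) SN] neq U unfolding bot_off_def by auto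
  then obtain i where i: "i \<in> U" "i \<notin> S" by (metis card_gt_0_iff all_not_in_conv Diff_iff)
  have "card U = card (U - S) + card (U \<inter> S)"
    using card_Int_Diff[OF fin(1), of S] by simp
  then have "card (U \<inter> S) < card S" using lt U by simp
  then have "\<not> S \<subseteq> U" by (metis inf.absorb2 less_irrefl)
  then obtain j where j: "j \<in> S" "j \<notin> U" by blast
  have "card (insert j (U - {i})) = t + 1" using U i j fin t_ge by simp
  moreover have "insert j (U - {i}) \<subseteq> N" using U j SN by blast
  ultimately have "b \<le> sum a (insert j (U - {i}))" using assms(1) unfolding cone_def by blast
  then have "a i \<le> a j" using U i j fin by (simp add: sum_diff1)
  moreover have "a j = v" "v \<le> a i" "a i \<noteq> v" using i j v S U by auto
  ultimately show False by simp
qed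

text \<open>Among the finitely many constraints, those tight at \<open>(a, b)\<close> are tight at
  \<open>weight S\<close> too and are unaffected by the subtraction; the others have room for a
  small multiple.\<close>

lemma subtract_weight:
  assumes c: "cone a b" and S: "S = {i \<in> N. a i = v}" and v: "\<And>i. i \<in> N \<Longrightarrow> v \<le> a i"
  obtains e where "0 < e" "cone (\<lambda>i. a i - e * weight S i) (b - e * offset S)"
proof -
  have fin: "finite {T. T \<subseteq> N \<and> P T}" for P by (rule finite_subset[of _ "Pow N"]) auto
  \<comment> \<open>The case distinction orients both families of inequalities so that the gap of
    \<open>(a, b)\<close> is to dominate \<open>e\<close> times the gap of
    \<open>weight S\<close>.\<close>
  have "\<exists>e>0. \<forall>x \<in> {T. T \<subseteq> N \<and> card T \<in> {t, t + 1}}.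
    e * (if card x = t then offset S - sum (weight S) x else sum (weight S) x - offset S)
      \<le> (if card x = t then b - sum a x else sum a x - b)"
  proof (rule uniform_scaling[OF fin])
    fix x assume x: "x \<in> {T. T \<subseteq> N \<and> card T \<in> {t, t + 1}}"
    then show "0 \<le> (if card x = t then b - sum a x else sum a x - b)"
      using c unfolding cone_def by auto
    assume tight: "(if card x = t then b - sum a x else sum a x - b) = 0"
    show "(if card x = t then offset S - sum (weight S) x else sum (weight S) x - offset S) \<le> 0"
    proof (cases "card x = t")
      case True
      then have "card (x - S) = top_off S" using tight_top[OF c S v, of x] x tight by simp
      then show ?thesis using sum_weight_top[of x S] x True by simp
    next
      case False
      then have "card (x - S) = bot_off S" using tight_bot[OF c S v, of x] x tight by simp
      then show ?thesis using sum_weight_bot[of x S] x False by simp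
    qed
  qed
  then obtain e where e: "e > 0" and le: "\<And>x. x \<subseteq> N \<Longrightarrow> card x \<in> {t, t + 1} \<Longrightarrow>
    e * (if card x = t then offset S - sum (weight S) x else sum (weight S) x - offset S)
      \<le> (if card x = t then b - sum a x else sum a x - b)" by blast
  have "cone (\<lambda>i. a i - e * weight S i) (b - e * offset S)"
    unfolding cone_def
  proof (intro conjI allI impI)
    fix T assume "T \<subseteq> N" "card T = t"
    then show "(\<Sum>i\<in>T. a i - e * weight S i) \<le> b - e * offset S"
      using le[of T] by (simp add: sum_subtractf algebra_simps flip: sum_distrib_left)
  next
    fix U assume "U \<subseteq> N" "card U = t + 1"
    then show "b - e * offset S \<le> (\<Sum>i\<in>U. a i - e * weight S i)"
      using le[of U] by (simp add: sum_subtractf algebra_simps flip: sum_distrib_left)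
  qed
  then show thesis using that e by blast
qed

section \<open>Extremality of the rays of good sets\<close>

text \<open>The first condition lets tight constraints compare any two elements outside
  \<open>S\<close>, the second any two inside; \<open>n - 1\<close> and \<open>1\<close> are the
  sizes for which the respective side is a single point.\<close>

definition good :: "nat set \<Rightarrow> bool" where
  "good S \<longleftrightarrow> proper S \<and> (card S < max (t + 1) (n - t) \<or> card S = n - 1) \<and>
     (min (t + 1) (n - t) < card S \<or> card S = 1)"

text \<open>Tight sets that differ by exchanging two elements on the same side of \<open>S\<close>
  show that \<open>a\<close> is constant on each side. One tight set of each size then fixes the two
  constants and \<open>b\<close> up to a common factor.\<close>

lemma weight_extreme:
  assumes S: "good S" and c: "cone a b"
    and top: "\<And>T. T \<subseteq> N \<Longrightarrow> card T = t \<Longrightarrow> card (T - S) = top_off S \<Longrightarrow> sum a T = b"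
    and bot: "\<And>U. U \<subseteq> N \<Longrightarrow> card U = t + 1 \<Longrightarrow> card (U - S) = bot_off S \<Longrightarrow> sum a U = b"
  obtains l where "0 \<le> l" "\<And>i. i \<in> N \<Longrightarrow> a i = l * weight S i" "b = l * offset S"
proof -
  define s where "s = card S"
  have pr: "proper S" using S unfolding good_def by blast
  have finS: "finite S" using pr finN by blast
  have s: "1 \<le> s" "s + 1 \<le> n" using proper_card[OF pr] unfolding s_def by auto
  have cNS: "card (N - S) = n - s" using pr finS unfolding s_def by (simp add: card_Diff_subset psubset_imp_subset)
  have off_const: "a i = a j" if ij: "i \<in> N - S" "j \<in> N - S" for i j
  proof (cases "i = j")
    case False
    have cW: "card (N - S - {i, j}) = n - s - 2"
      using cNS ij False by (simp add: card_Diff_subset)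
    have "card {i, j} \<le> card (N - S)" using ij by (intro card_mono) auto
    then have "2 \<le> n - s" using cNS False by simp
    \<comment> \<open>In the first case tight \<open>t\<close>-sets can be taken disjoint from
      \<open>S\<close>; in the second, tight \<open>(t + 1)\<close>-sets contain \<open>S\<close>.
      Either way there is room to exchange \<open>i\<close> and \<open>j\<close>.\<close>
    then have "t < n - s \<or> s \<le> t" using S unfolding good_def s_def[symmetric] by auto
    then show ?thesis
    proof
      assume ts: "t < n - s"
      have "t - 1 \<le> card (N - S - {i, j})" unfolding cW using ts by linarith
      from ex_subset_card[OF this] obtain W where W: "W \<subseteq> N - S - {i, j}" "card W = t - 1"
        by (elim exE conjE)
      then have "finite W" using finN[of W] by blast
      have "sum a (insert k W) = b" if "k \<in> {i, j}" for k
      proof (rule top)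
        have k: "k \<notin> W" "insert k W - S = insert k W" using that W ij by auto
        show "insert k W \<subseteq> N" using that W ij by auto
        show "card (insert k W) = t" using k \<open>finite W\<close> W t_ge by simp
        then show "card (insert k W - S) = top_off S" using k ts unfolding top_off_def s_def by simp
      qed
      from this[of i] this[of j] have "sum a (insert i W) = sum a (insert j W)" by simp
      moreover have "i \<notin> W" "j \<notin> W" using W(1) ij by blast+
      ultimately show ?thesis using \<open>finite W\<close> finS by simp
    next
      assume st: "s \<le> t"
      have "t - s \<le> card (N - S - {i, j})" unfolding cW using t_le st s by linarith
      from ex_subset_card[OF this] obtain W where W: "W \<subseteq> N - S - {i, j}" "card W = t - s"
        by (elim exE conjE)
      then have "finite W" using finN[of W] by blast
      have "sum a (insert k (S \<union> W)) = b" if "k \<in> {i, j}" for k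
      proof (rule bot)
        have k: "k \<notin> S \<union> W" "insert k (S \<union> W) - S = insert k W" "S \<inter> W = {}" using that W ij by auto
        show "insert k (S \<union> W) \<subseteq> N" using that W ij pr by auto
        show "card (insert k (S \<union> W)) = t + 1"
          using k \<open>finite W\<close> finS W st by (simp add: card_Un_disjoint s_def)
        show "card (insert k (S \<union> W) - S) = bot_off S"
          using k \<open>finite W\<close> st W unfolding bot_off_def s_def by auto
      qed
      from this[of i] this[of j] have "sum a (insert i (S \<union> W)) = sum a (insert j (S \<union> W))" by simp
      moreover have "i \<notin> (S \<union> W)" "j \<notin> (S \<union> W)" using W(1) ij by blast+
      ultimately show ?thesis using \<open>finite W\<close> finS by simp
    qed
  qed simp
  have on_const: "a i = a j" if ij: "i \<in> S" "j \<in> S" for i j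
  proof (cases "i = j")
    case False
    have cW: "card (S - {i, j}) = s - 2"
      using ij False unfolding s_def by (simp add: card_Diff_subset)
    have "card {i, j} \<le> s" unfolding s_def using ij finS by (intro card_mono) auto
    then have "2 \<le> s" using False by simp
    \<comment> \<open>In the first case tight \<open>t\<close>-sets contain \<open>N - S\<close> and
      at least one element of \<open>S\<close>; in the second, tight \<open>(t + 1)\<close>-sets lie
      inside \<open>S\<close>.\<close>
    then have "n - t < s \<or> t + 1 < s" using S unfolding good_def s_def[symmetric] by auto
    then show ?thesis
    proof
      assume ts: "n - t < s"
      have "t - 1 - (n - s) \<le> card (S - {i, j})" unfolding cW using t_le by linarith
      from ex_subset_card[OF this] obtain W where W: "W \<subseteq> S - {i, j}" "card W = t - 1 - (n - s)"
        by (elim exE conjE)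
      then have "finite W" using finS finite_subset by blast
      have "sum a (insert k ((N - S) \<union> W)) = b" if "k \<in> {i, j}" for k
      proof (rule top)
        have k: "k \<notin> (N - S) \<union> W" "insert k ((N - S) \<union> W) - S = N - S" "(N - S) \<inter> W = {}"
          using that W ij by auto
        show "insert k ((N - S) \<union> W) \<subseteq> N" using that W ij pr by auto
        have "card ((N - S) \<union> W) = n - s + (t - 1 - (n - s))"
          using card_Un_disjoint[OF _ \<open>finite W\<close> k(3)] cNS W by simp
        then show "card (insert k ((N - S) \<union> W)) = t"
          using k \<open>finite W\<close> ts s by simp
        show "card (insert k ((N - S) \<union> W) - S) = top_off S"
          unfolding k(2) cNS using ts unfolding top_off_def s_def by simp
      qed
      from this[of i] this[of j] have "sum a (insert i ((N - S) \<union> W)) = sum a (insert j ((N - S) \<union> W))" by simp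
      moreover have "i \<notin> ((N - S) \<union> W)" "j \<notin> ((N - S) \<union> W)" using W(1) ij by blast+
      ultimately show ?thesis using \<open>finite W\<close> finS by simp
    next
      assume st: "t + 1 < s"
      have "t \<le> card (S - {i, j})" unfolding cW using st by linarith
      from ex_subset_card[OF this] obtain W where W: "W \<subseteq> S - {i, j}" "card W = t"
        by (elim exE conjE)
      then have "finite W" using finS finite_subset by blast
      have "sum a (insert k W) = b" if "k \<in> {i, j}" for k
      proof (rule bot)
        have k: "k \<notin> W" "insert k W - S = {}" using that W ij by auto
        show "insert k W \<subseteq> N" using that W ij pr by auto
        show "card (insert k W) = t + 1" using k \<open>finite W\<close> W by simp
        show "card (insert k W - S) = bot_off S" unfolding k(2) using st unfolding bot_off_def s_def by simp
      qed
      from this[of i] this[of j] have "sum a (insert i W) = sum a (insert j W)" by simp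
      moreover have "i \<notin> W" "j \<notin> W" using W(1) ij by blast+
      ultimately show ?thesis using \<open>finite W\<close> finS by simp
    qed
  qed simp
  obtain x0 y0 where x0: "x0 \<in> N - S" and y0: "y0 \<in> S" using pr by blast
  define x where "x = a x0"
  define y where "y = a y0"
  have sum_ab: "sum a (P \<union> Q) = real (card P) * x + real (card Q) * y"
    if "P \<subseteq> N - S" "Q \<subseteq> S" for P Q
  proof -
    have "P \<inter> Q = {}" using that by blast
    moreover have "finite P" "finite Q" using that finS finite_subset[of P N] finite_subset[of Q S] by auto
    ultimately have "sum a (P \<union> Q) = sum a P + sum a Q" by (simp add: sum.union_disjoint)
    also have "sum a P = (\<Sum>i\<in>P. x)"
      unfolding x_def using that x0 by (intro sum.cong off_const) auto
    also have "sum a Q = (\<Sum>i\<in>Q. y)"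
      unfolding y_def using that y0 by (intro sum.cong on_const) auto
    finally show ?thesis by simp
  qed
  have level: "\<exists>P Q. P \<subseteq> N - S \<and> Q \<subseteq> S \<and> card P = p \<and> card Q = q \<and>
      P \<union> Q \<subseteq> N \<and> card (P \<union> Q) = p + q \<and> P \<union> Q - S = P"
    if bounds: "p \<le> n - s" "q \<le> s" for p q
  proof -
    obtain P where P: "P \<subseteq> N - S" "card P = p"
      using ex_subset_card[of p "N - S"] bounds cNS by auto
    obtain Q where Q: "Q \<subseteq> S" "card Q = q"
      using ex_subset_card[of q S] bounds unfolding s_def by auto
    have "finite P" "finite Q" using P Q finS finite_subset[of P N] finite_subset[of Q S] by auto
    then have "card (P \<union> Q) = p + q" using P Q by (subst card_Un_disjoint) auto
    then show ?thesis using P Q pr by blast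
  qed
  define p where "p = top_off S"
  define q where "q = bot_off S"
  have pq: "p \<le> t" "p \<le> n - s" "t - p \<le> s" "q \<le> t + 1" "q \<le> n - s" "t + 1 - q \<le> s"
    using s t_le unfolding p_def q_def top_off_def bot_off_def s_def[symmetric] by auto
  obtain P Q where PQ: "P \<subseteq> N - S" "Q \<subseteq> S" "card P = p" "card Q = t - p"
      "P \<union> Q \<subseteq> N" "card (P \<union> Q) = t" "P \<union> Q - S = P"
    using level[OF pq(2,3)] pq(1) by auto
  then have "real p * x + real (t - p) * y = b"
    using top[of "P \<union> Q"] sum_ab[of P Q] unfolding p_def by simp
  then have e1: "real p * x + (real t - real p) * y = b" using pq by (simp add: of_nat_diff)
  obtain P Q where PQ: "P \<subseteq> N - S" "Q \<subseteq> S" "card P = q" "card Q = t + 1 - q"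
      "P \<union> Q \<subseteq> N" "card (P \<union> Q) = t + 1" "P \<union> Q - S = P"
    using level[OF pq(5,6)] pq(4) by auto
  then have "real q * x + real (t + 1 - q) * y = b"
    using bot[of "P \<union> Q"] sum_ab[of P Q] unfolding q_def by simp
  moreover have "real (t + 1 - q) = real t + 1 - real q" using pq by (simp add: of_nat_diff)
  ultimately have e2: "real q * x + (real t + 1 - real q) * y = b" by (simp only:)
  define h where "h = height S"
  have h: "h = real p - real q" "0 \<le> h" using height_nonneg[OF pr] unfolding h_def height_def p_def q_def by auto
  \<comment> \<open>The difference of the two tight equations; it says that \<open>(x, y)\<close> is
    \<open>x - y\<close> times \<open>(h + 1, h)\<close>.\<close>
  have hx: "h * x = (h + 1) * y" using e1 e2 unfolding h(1) by (simp add: algebra_simps)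
  have ly: "y = (x - y) * h" and lx: "x = (x - y) * (h + 1)" using hx by (simp_all add: algebra_simps)
  have "0 \<le> x" unfolding x_def using cone_nonneg[OF c] x0 by blast
  then have "0 \<le> x - y" using lx h(2)
    by (metis add_nonneg_pos linorder_not_le mult_neg_pos zero_less_one)
  moreover have "a i = (x - y) * weight S i" if "i \<in> N" for i
  proof (cases "i \<in> S")
    case True
    then have "a i = y" unfolding y_def using on_const y0 by blast
    then show ?thesis using True ly unfolding weight_def h_def by simp
  next
    case False
    then have "a i = x" unfolding x_def using off_const x0 that by blast
    then show ?thesis using False lx unfolding weight_def h_def by simp
  qed
  moreover have "b = (x - y) * offset S"
  proof -
    have "(x - y) * offset S = real t * ((x - y) * h) + real p * (x - y)"
      unfolding offset_def h_def p_def by (simp add: algebra_simps)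
    also have "\<dots> = real t * y + real p * (x - y)" using ly by simp
    finally show ?thesis using e1 by (simp add: algebra_simps)
  qed
  ultimately show thesis using that by blast
qed

text \<open>Both summands have nonnegative slacks, so a zero sum forces each to be zero.\<close>

lemma flat_summand:
  assumes "flat f" "supermodular n g" "supermodular n g'" "\<And>I. I \<subseteq> N \<Longrightarrow> f I = g I + g' I"
  shows "flat g"
  unfolding flat_def
proof (intro ballI impI)
  fix I J assume IJ: "I \<in> Pow N" "J \<in> Pow N" and c: "close_pair I J \<and> card I \<notin> {t, t + 1}"
  have "slack f I J = 0" using assms(1) IJ c unfolding flat_def by blast
  moreover have "slack f I J = slack g I J + slack g' I J"
  proof -
    have "I \<subseteq> N" "J \<subseteq> N" "I \<inter> J \<subseteq> N" "I \<union> J \<subseteq> N" using IJ by auto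
    then show ?thesis unfolding slack_def by (simp only: assms(4))
  qed
  moreover have "g I + g J \<le> g (I \<inter> J) + g (I \<union> J)" "g' I + g' J \<le> g' (I \<inter> J) + g' (I \<union> J)"
    using assms(2,3) IJ unfolding supermodular_def by blast+
  then have "slack g I J \<ge> 0" "slack g' I J \<ge> 0" unfolding slack_def by linarith+
  ultimately show "slack g I J = 0" by linarith
qed

text \<open>The subtracted term is the modular function agreeing with \<open>g\<close> on the empty
  set and the singletons.\<close>

definition normal :: "(nat set \<Rightarrow> real) \<Rightarrow> nat set \<Rightarrow> real" where
  "normal g I = g I - (g {} + (\<Sum>i\<in>I. g {i} - g {}))"

lemma normal_small: "I \<subseteq> N \<Longrightarrow> card I \<le> 1 \<Longrightarrow> normal g I = 0"
  using finN[of I] by (cases "I = {}") (auto simp: normal_def card_le_Suc0_iff_eq le_Suc_eq card_1_singleton_iff)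

lemma supermodular_normal:
  assumes "supermodular n g"
  shows "supermodular n (normal g)"
  unfolding supermodular_def
proof (intro ballI)
  fix I J assume IJ: "I \<in> Pow N" "J \<in> Pow N"
  have "g (I \<inter> J) + g (I \<union> J) \<ge> g I + g J" using assms IJ unfolding supermodular_def by blast
  moreover have "finite I" "finite J" using IJ finN by auto
  then have "(\<Sum>i\<in>I \<union> J. g {i} - g {}) + (\<Sum>i\<in>I \<inter> J. g {i} - g {})
      = (\<Sum>i\<in>I. g {i} - g {}) + (\<Sum>i\<in>J. g {i} - g {})" by (rule sum.union_inter)
  ultimately show "normal g (I \<inter> J) + normal g (I \<union> J) \<ge> normal g I + normal g J"
    unfolding normal_def by linarith
qed

text \<open>After normalisation both summands are ramps of cone pairs adding up to
  \<open>(weight S, offset S)\<close>. A constraint tight for the sum is tight for each summand, so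
  \<open>weight_extreme\<close> applies.\<close>

lemma ray_summand:
  assumes S: "good S" and g: "supermodular n g" "supermodular n g'"
    and eq: "\<And>I. I \<subseteq> N \<Longrightarrow> ray S I = g I + g' I"
  shows "\<exists>l\<ge>0. modular n (\<lambda>I. g I - l * ray S I)"
proof -
  have pr: "proper S" using S unfolding good_def by blast
  have c: "cone (weight S) (offset S)" using cone_weight pr by blast
  have f0: "ray S I = 0" if "I \<subseteq> N" "card I \<le> 1" for I
    using standard_ray[OF pr] that unfolding standard_supermodular_def by blast
  have neq: "ray S I = normal g I + normal g' I" if "I \<subseteq> N" for I
  proof -
    have "g {i} - g {} + (g' {i} - g' {}) = 0" if "i \<in> I" for i
      using eq[of "{i}"] eq[of "{}"] f0[of "{i}"] f0[of "{}"] that \<open>I \<subseteq> N\<close> by auto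
    then have "(\<Sum>i\<in>I. g {i} - g {}) + (\<Sum>i\<in>I. g' {i} - g' {}) = 0"
      by (simp flip: sum.distrib)
    moreover have "g {} + g' {} = 0" using eq[of "{}"] f0[of "{}"] by simp
    ultimately show ?thesis using eq[OF that] unfolding normal_def by linarith
  qed
  note sg = supermodular_normal[OF g(1)] and sg' = supermodular_normal[OF g(2)]
  have fl: "flat (ray S)" unfolding ray_def by (rule flat_ramp[OF c])
  obtain a b where ab: "cone a b" "\<And>I. I \<subseteq> N \<Longrightarrow> normal g I = ramp a b I"
    using flat_supermodular_ramp[OF flat_summand[OF fl sg sg' neq] normal_small sg] by metis
  have "ray S I = normal g' I + normal g I" if "I \<subseteq> N" for I using neq[OF that] by simp
  from flat_summand[OF fl sg' sg this]
  obtain a' b' where ab': "cone a' b'" "\<And>I. I \<subseteq> N \<Longrightarrow> normal g' I = ramp a' b' I"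
    using flat_supermodular_ramp[OF _ normal_small sg'] by metis
  have "ramp (weight S) (offset S) I = ramp (\<lambda>i. a i + a' i) (b + b') I" if "I \<subseteq> N" for I
    using neq[OF that] ab(2)[OF that] ab'(2)[OF that] ramp_add[OF ab(1) ab'(1) that]
    unfolding ray_def by simp
  note add = ramp_inject[OF c cone_add[OF ab(1) ab'(1)] this]
  have sadd: "sum (weight S) I = sum a I + sum a' I" if "I \<subseteq> N" for I
  proof -
    have "sum (weight S) I = (\<Sum>i\<in>I. a i + a' i)" using that add(1) by (intro sum.cong) auto
    then show ?thesis by (simp add: sum.distrib)
  qed
  have top: "sum a T = b" if T: "T \<subseteq> N" "card T = t" "card (T - S) = top_off S" for T
  proof -
    have "sum a T \<le> b" "sum a' T \<le> b'" using ab ab' T unfolding cone_def by blast+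
    then show ?thesis using sum_weight_top[OF T] sadd[OF T(1)] add(2) by linarith
  qed
  have bot: "sum a U = b" if U: "U \<subseteq> N" "card U = t + 1" "card (U - S) = bot_off S" for U
  proof -
    have "b \<le> sum a U" "b' \<le> sum a' U" using ab ab' U unfolding cone_def by blast+
    then show ?thesis using sum_weight_bot[OF U] sadd[OF U(1)] add(2) by linarith
  qed
  obtain l where l: "0 \<le> l" "\<And>i. i \<in> N \<Longrightarrow> a i = l * weight S i" "b = l * offset S"
    using weight_extreme[OF S ab(1) top bot] by blast
  have "normal g I = l * ray S I" if "I \<subseteq> N" for I
    using ab(2)[OF that] ramp_cong[of a "\<lambda>i. l * weight S i", OF l(2) that] ramp_scale[OF l(1)] l(3)
    unfolding ray_def by simp
  \<comment> \<open>The difference from the multiple of the ray is exactly what normalisation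
    removed, hence modular.\<close>
  then have "g {} + (\<Sum>i\<in>I. g {i} - g {}) = g I - l * ray S I" if "I \<subseteq> N" for I
    using \<open>\<And>I. I \<subseteq> N \<Longrightarrow> normal g I = l * ray S I\<close>[OF that] unfolding normal_def by linarith
  from modular_cong[OF modular_affine this] l(1) show ?thesis by blast
qed

lemma irreducible_ray:
  assumes "good S"
  shows "irreducible_supermodular n (ray S)"
proof -
  have st: "standard_supermodular n (ray S)" using assms standard_ray unfolding good_def by blast
  have "(\<exists>c1\<ge>0. modular n (\<lambda>I. g1 I - c1 * ray S I)) \<and> (\<exists>c2\<ge>0. modular n (\<lambda>I. g2 I - c2 * ray S I))"
    if "supermodular n g1" "supermodular n g2" "\<forall>I\<in>Pow N. ray S I = g1 I + g2 I" for g1 g2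
    using ray_summand[OF assms that(1,2)] ray_summand[OF assms that(2,1)] that(3) by (simp add: add.commute)
  then show ?thesis
    using st standard_not_modular[OF st]
    unfolding irreducible_supermodular_def standard_supermodular_def by blast
qed

section \<open>Rays of the remaining sets split\<close>

lemma ray_add:
  assumes "S \<subseteq> N" "R \<subseteq> N" "Q \<subseteq> N" "\<And>i. i \<in> N \<Longrightarrow> weight S i = weight R i + weight Q i" "offset S = offset R + offset Q"
    and "I \<subseteq> N"
  shows "ray S I = ray R I + ray Q I"
proof -
  have "ray S I = ramp (\<lambda>i. weight R i + weight Q i) (offset R + offset Q) I"
    unfolding ray_def assms(5) by (rule ramp_cong[OF assms(4,6)])
  then show ?thesis
    using ramp_add[OF cone_weight[OF assms(2)] cone_weight[OF assms(3)] assms(6)] unfolding ray_def by simp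
qed

lemma irreducible_ray_good:
  assumes pr: "proper S" and irr: "irreducible_supermodular n (ray S)"
  shows "good S"
proof (rule ccontr)
  assume "\<not> good S"
  have finS: "finite S" using pr finN by blast
  have s: "1 \<le> card S" "card S + 1 \<le> n" using proper_card[OF pr] by auto
  \<comment> \<open>Irreducibility would identify \<open>ray S\<close> with its summand
    \<open>ray R\<close>, and hence \<open>S\<close> with \<open>R\<close>.\<close>
  have split: False if R: "proper R" and Q: "proper Q"
    and v: "\<And>i. i \<in> N \<Longrightarrow> weight S i = weight R i + weight Q i" and o: "offset S = offset R + offset Q"
    and ne: "R \<noteq> S" for R Q
  proof -
    have sub: "S \<subseteq> N" "R \<subseteq> N" "Q \<subseteq> N" using pr R Q by blast+
    have "ray Q I = ray S I - 1 * ray R I" if "I \<subseteq> N" for I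
      using ray_add[OF sub v o that] by simp
    moreover have "supermodular n (ray Q)"
      using standard_ray[OF Q] unfolding standard_supermodular_def by blast
    ultimately have sup: "supermodular n (\<lambda>I. ray S I - 1 * ray R I)"
      using supermodular_cong[of n "ray Q" "\<lambda>I. ray S I - 1 * ray R I"] by blast
    have "ray S I = ray R I" if "I \<subseteq> N" for I
      by (rule irreducible_eq_standard_summand[OF irr standard_ray[OF pr] standard_ray[OF R] zero_less_one sup that])
    then show False using ray_inject[OF pr R] ne by blast
  qed
  consider "card S \<le> min (t + 1) (n - t)" "2 \<le> card S" | "max (t + 1) (n - t) \<le> card S" "card S + 2 \<le> n"
    using \<open>\<not> good S\<close> pr s unfolding good_def by linarith
  then show False
  proof cases
    case 1
    obtain k where k: "k \<in> S" using pr by blast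
    have cards: "card (S - {k}) = card S - 1" using k finS by simp
    have p1: "proper {k}" using k pr t_le s by auto
    have "card (S - {k}) \<noteq> 0" using cards 1 by linarith
    then have "S - {k} \<noteq> {}" by (metis card.empty)
    then have p2: "proper (S - {k})" using pr by blast
    \<comment> \<open>For small \<open>S\<close> the bound \<open>n - card S\<close> is inactive, so
      \<open>height S\<close> is \<open>card S - 1\<close>. The missing 1 in the sum of heights is
      supplied because each element of \<open>S\<close> lies in exactly one of \<open>{k}\<close>
      and \<open>S - {k}\<close>.\<close>
    have tops: "top_off {k} = t" "top_off S = t" "top_off (S - {k}) = t"
      using 1 t_le unfolding top_off_def cards by auto
    have "bot_off S + card S = t + 1" "bot_off (S - {k}) + card S = t + 2" "bot_off {k} = t"
      using 1 unfolding bot_off_def cards by auto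
    then have heights: "height S = real (card S) - 1" "height (S - {k}) = real (card S) - 2" "height {k} = 0"
      unfolding height_def tops by linarith+
    have v: "weight S i = weight {k} i + weight (S - {k}) i" if "i \<in> N" for i
      using k unfolding weight_def heights by auto
    have o: "offset S = offset {k} + offset (S - {k})"
      unfolding offset_def heights tops by (simp add: algebra_simps)
    have ne: "{k} \<noteq> S" using 1 by auto
    show False by (rule split[OF p1 p2 v o ne])
  next
    case 2
    obtain k where k: "k \<in> N" "k \<notin> S" using pr by blast
    have cards: "card (insert k S) = card S + 1" "card (N - {k}) = n - 1" using k finS by auto
    have "card (N - {k}) \<noteq> 0" using cards t_le by linarith
    then have "N - {k} \<noteq> {}" by (metis card.empty)
    then have p1: "proper (N - {k})" using k by blast
    have "insert k S \<noteq> N" using cards(1) 2 by auto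
    then have p2: "proper (insert k S)" using pr k by blast
    \<comment> \<open>For large \<open>S\<close> the lower count is 0 and heights add exactly. Each
      element outside \<open>S\<close> is missing from exactly one of \<open>N - {k}\<close> and
      \<open>insert k S\<close>.\<close>
    have "bot_off S = 0" "bot_off (insert k S) = 0" "bot_off (N - {k}) = 0"
      "top_off S + card S = n" "top_off (insert k S) + card S + 1 = n" "top_off (N - {k}) = 1"
      using 2 t_ge t_le unfolding top_off_def bot_off_def cards by auto
    then have tops: "real (top_off S) = real n - real (card S)"
        "real (top_off (insert k S)) = real n - real (card S) - 1" "real (top_off (N - {k})) = 1"
      and heights: "height S = real n - real (card S)"
        "height (insert k S) = real n - real (card S) - 1" "height (N - {k}) = 1"
      unfolding height_def by linarith+
    have v: "weight S i = weight (N - {k}) i + weight (insert k S) i" if "i \<in> N" for i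
      using k that unfolding weight_def heights by auto
    have o: "offset S = offset (N - {k}) + offset (insert k S)"
      unfolding offset_def heights tops by (simp add: algebra_simps)
    have ne: "N - {k} \<noteq> S" using 2 cards by auto
    show False by (rule split[OF p1 p2 v o ne])
  qed
qed

section \<open>Classification of the irreducible functions\<close>

lemma irreducible_cases:
  assumes irr: "irreducible_supermodular n f" and st: "standard_supermodular n f" and "flat f"
  shows "(\<forall>I \<subseteq> N. f I = alpha n t I) \<or> (\<forall>I \<subseteq> N. f I = alpha n (t + 1) I) \<or>
    (\<exists>S. good S \<and> (\<forall>I \<subseteq> N. f I = ray S I))"
proof -
  obtain a b where ab: "cone a b" "\<And>I. I \<subseteq> N \<Longrightarrow> f I = ramp a b I"
    using flat_supermodular_ramp[OF assms(3)] st unfolding standard_supermodular_def by blast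
  define v where "v = Min (a ` N)"
  define S where "S = {i \<in> N. a i = v}"
  have ne: "N \<noteq> {}" using t_le by simp
  have v: "v \<le> a i" if "i \<in> N" for i unfolding v_def using that by simp
  have "v \<in> a ` N" unfolding v_def using ne by (intro Min_in) auto
  then have "S \<noteq> {}" unfolding S_def by auto
  show ?thesis
  proof (cases "S = N")
    case False
    then have pr: "proper S" using \<open>S \<noteq> {}\<close> unfolding S_def by blast
    obtain e where e: "0 < e" "cone (\<lambda>i. a i - e * weight S i) (b - e * offset S)"
      using subtract_weight[OF ab(1) S_def v] .
    have "ramp (\<lambda>i. a i - e * weight S i) (b - e * offset S) I = f I - e * ray S I" if "I \<subseteq> N" for I
    proof -
      have c: "cone (weight S) (offset S)" using cone_weight pr by blast
      show ?thesis
        unfolding ray_def ab(2)[OF that] ramp_eq[OF e(2) that] ramp_eq[OF ab(1) that] ramp_eq[OF c that]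
        by (simp add: sum_subtractf algebra_simps flip: sum_distrib_left)
    qed
    with supermodular_cone[OF e(2)] have "supermodular n (\<lambda>I. f I - e * ray S I)"
      by (rule supermodular_cong)
    then have eq: "f I = ray S I" if "I \<subseteq> N" for I
      using irreducible_eq_standard_summand[OF irr st standard_ray[OF pr] e(1)] that by blast
    \<comment> \<open>Irreducibility passes from \<open>f\<close> to the ray, which excludes the
      sets whose ray splits.\<close>
    have "irreducible_supermodular n (ray S)"
      using irreducible_cong[OF irr] eq by blast
    then show ?thesis using irreducible_ray_good[OF pr] eq by blast
  next
    case True
    have const: "f I = max 0 (real (card I) * v - b)" if "I \<subseteq> N" for I
    proof -
      have "sum a I = (\<Sum>i\<in>I. v)" using True that unfolding S_def by (intro sum.cong) auto
      then show ?thesis using ab(2)[OF that] unfolding ramp_def by simp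
    qed
    obtain T where T: "T \<subseteq> N" "card T = t"
      using ex_subset_card[of t N] t_le by auto
    obtain U where U: "U \<subseteq> N" "card U = t + 1"
      using ex_subset_card[of "t + 1" N] t_le by auto
    have "sum a I = (\<Sum>i\<in>I. v)" if "I \<subseteq> N" for I
      using True that unfolding S_def by (intro sum.cong) auto
    from this[OF T(1)] this[OF U(1)] have bounds: "real t * v \<le> b" "b \<le> (real t + 1) * v"
      using ab(1) T U unfolding cone_def by (auto simp: algebra_simps)
    have "0 \<le> v" using bounds by (simp add: algebra_simps)
    \<comment> \<open>Both coefficients are nonnegative by \<open>bounds\<close>; they add up to
      \<open>v\<close>.\<close>
    have fI: "f I = ((real t + 1) * v - b) * alpha n t I + (b - real t * v) * alpha n (t + 1) I"
      if "I \<subseteq> N" for I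
    proof (cases "card I \<le> t")
      case True
      then have "real (card I) * v \<le> real t * v" using \<open>0 \<le> v\<close> by (simp add: mult_right_mono)
      then have "f I = 0" using const[OF that] bounds by simp
      then show ?thesis using True that by (simp add: alpha_def)
    next
      case False
      then have "(real t + 1) * v \<le> real (card I) * v" using \<open>0 \<le> v\<close> by (intro mult_right_mono) auto
      then have "f I = real (card I) * v - b" using const[OF that] bounds by simp
      then show ?thesis using False that by (simp add: alpha_def algebra_simps)
    qed
    have supa: "supermodular n (alpha n u)" if "u \<in> {t, t + 1}" for u
      using standard_alpha[of u] that t_ge t_le unfolding standard_supermodular_def by auto
    show ?thesis
    \<comment> \<open>A positive coefficient of \<open>alpha n t\<close> identifies \<open>f\<close>
      with it; otherwise only the multiple of \<open>alpha n (t + 1)\<close> remains.\<close>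
    proof (cases "b < (real t + 1) * v")
      case True
      have "supermodular n (\<lambda>I. (b - real t * v) * alpha n (t + 1) I)"
        using supermodular_scale[OF supa[of "t + 1"]] bounds by simp
      then have "supermodular n (\<lambda>I. f I - ((real t + 1) * v - b) * alpha n t I)"
        by (rule supermodular_cong) (simp add: fI)
      then show ?thesis
        using irreducible_eq_standard_summand[OF irr st standard_alpha, of t "(real t + 1) * v - b"] True t_ge t_le
        by simp
    next
      case False
      then have b: "b = (real t + 1) * v" using bounds by simp
      then have fI: "f I = v * alpha n (t + 1) I" if "I \<subseteq> N" for I
        using fI[OF that] by (simp add: algebra_simps)
      have "v \<noteq> 0" using standard_not_all_0[OF st] fI by (metis mult_zero_left)
      moreover have "supermodular n (\<lambda>I. f I - v * alpha n (t + 1) I)"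
        using fI unfolding supermodular_def by (auto simp: le_infI1)
      ultimately show ?thesis
        using irreducible_eq_standard_summand[OF irr st standard_alpha, of "t + 1" v] \<open>0 \<le> v\<close> t_ge t_le by simp
    qed
  qed
qed

section \<open>The explicit formula, the index sets and the bijection\<close>

text \<open>Above level \<open>t\<close> both sides are affine in the sizes of \<open>I\<close> and
  \<open>I \<inter> S\<close>. The coefficients of the two \<open>alpha\<close> terms are the
  truncation corrections: \<open>top_off S\<close> is \<open>t\<close> minus the second, and
  \<open>bot_off S\<close> is \<open>t + 1 - card S\<close>, taken in the reals, plus the
  first.\<close>

lemma ray_formula:
  assumes pr: "proper S" and I: "I \<subseteq> N"
  shows "(\<Sum>k\<in>S. beta n t k I) - max 0 (real (card S) - (real t + 1)) * alpha n t I
    - max 0 (real (card S) - (real n - real t)) * alpha n (t + 1) I = ray S I"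
proof -
  have fin: "finite S" "finite I" using pr I finN by blast+
  have cI: "card (I \<inter> (N - {k})) = card I - (if k \<in> I then 1 else 0)" for k
  proof -
    have "I \<inter> (N - {k}) = I - {k}" using I by blast
    then show ?thesis by simp
  qed
  have c: "cone (weight S) (offset S)" using cone_weight pr by blast
  show ?thesis
  proof (cases "card I \<le> t")
    case True
    then have "ray S I = 0" using ramp_eq[OF c I] unfolding ray_def by simp
    moreover have "beta n t k I = 0" for k using I cI[of k] True by (simp add: beta_def)
    ultimately show ?thesis using True I by (simp add: alpha_def)
  next
    case False
    define m where "m = real (card I)"
    define w where "w = real (card (I \<inter> S))"
    define x where "x = max 0 (real (card S) - (real t + 1))"
    define y where "y = max 0 (real (card S) - (real n - real t))"
    have "beta n t k I = m - real t - (if k \<in> I then 1 else 0)" for k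
      using I False cI[of k] by (auto simp: beta_def m_def of_nat_diff)
    then have sumb: "(\<Sum>k\<in>S. beta n t k I) = real (card S) * (m - real t) - w"
      using fin by (simp add: sum_subtractf sum.If_cases w_def Int_commute)
    have al: "alpha n t I = m - real t" "alpha n (t + 1) I = m - real t - 1"
      using False I by (auto simp: alpha_def m_def)
    have "card (I - S) + card (I \<inter> S) = card I"
      using card_Int_Diff[OF fin(2), of S] by simp
    then have "real (card (I - S)) = m - w" unfolding m_def w_def by linarith
    then have fnI: "ray S I = m * height S + m - w - offset S"
      using False ramp_eq[OF c I] sum_weight[OF I, of S] unfolding ray_def m_def by simp
    have top: "real (top_off S) = real t - y"
      using proper_card[OF pr] t_le unfolding top_off_def y_def
      by (auto simp: of_nat_diff min_def max_def)
    have h: "height S = real (card S) - x - y - 1"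
      using proper_card[OF pr] t_le unfolding height_def top_off_def bot_off_def x_def y_def
      by (auto simp: of_nat_diff min_def max_def)
    show ?thesis
      unfolding x_def[symmetric] y_def[symmetric] sumb al fnI offset_def top h by (simp add: algebra_simps)
  qed
qed

text \<open>The function \<open>alpha n u\<close> is the ramp of the constant weight 1, whereas the
  weight of a proper set takes two values.\<close>

lemma ray_not_alpha:
  assumes pr: "proper S" and u: "u \<in> {t, t + 1}"
  shows "\<exists>I \<subseteq> N. ray S I \<noteq> alpha n u I"
proof (rule ccontr)
  assume "\<not> ?thesis"
  then have "ray S I = ramp (\<lambda>i. 1) (real u) I" if "I \<subseteq> N" for I
    using that unfolding ramp_def alpha_def by auto
  moreover have c: "cone (\<lambda>i. 1) (real u)" unfolding cone_def using u by auto
  ultimately have "\<forall>i\<in>N. weight S i = 1"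
    using ramp_inject(1)[OF cone_weight c, of S] pr unfolding ray_def by blast
  moreover obtain i j where "i \<in> S" "j \<in> N - S" using pr by blast
  moreover have "i \<in> N" using \<open>i \<in> S\<close> pr by blast
  ultimately have "weight S i = weight S j" by simp
  then show False using \<open>i \<in> S\<close> \<open>j \<in> N - S\<close> unfolding weight_def by simp
qed

text \<open>If \<open>n > 3\<close>, then \<open>n - 1\<close> exceeds
  \<open>min (t + 1) (n - t)\<close>. If \<open>n = 3\<close>, then \<open>t = 1\<close> and both
  are 2, so a set of size 2 satisfies only half of \<open>good\<close>: its ray is the sum of the
  rays of its two singletons. The last clause excludes this case.\<close>

lemma good_iff:
  "good S \<longleftrightarrow> S \<subseteq> N \<and>
    (card S \<in> {1, n - 1} \<or> min (t + 1) (n - t) < card S \<and> card S < max (t + 1) (n - t)) \<and>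
    \<not> (n = 3 \<and> card S = 2)"
proof
  assume "good S"
  then show "S \<subseteq> N \<and>
    (card S \<in> {1, n - 1} \<or> min (t + 1) (n - t) < card S \<and> card S < max (t + 1) (n - t)) \<and>
    \<not> (n = 3 \<and> card S = 2)"
    using t_ge t_le unfolding good_def by auto
next
  assume R: "S \<subseteq> N \<and>
    (card S \<in> {1, n - 1} \<or> min (t + 1) (n - t) < card S \<and> card S < max (t + 1) (n - t)) \<and>
    \<not> (n = 3 \<and> card S = 2)"
  then have "1 \<le> card S" "card S < n" using t_ge t_le by auto
  then have "proper S" using R by auto
  then show "good S" using R t_ge t_le unfolding good_def by auto
qed

lemma K_set_iff:
  "f \<in> K_set n t \<longleftrightarrow>
    f \<in> extensional (Pow N) \<and> standard_supermodular n f \<and> irreducible_supermodular n f \<and> flat f"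
  unfolding K_set_def flat_def by blast

lemma standard_cong:
  assumes "standard_supermodular n f" and eq: "\<And>I. I \<subseteq> N \<Longrightarrow> f I = g I"
  shows "standard_supermodular n g"
proof -
  have "{m :: nat. \<exists>I \<in> Pow N. g I = real m} = {m :: nat. \<exists>I \<in> Pow N. f I = real m}"
    using eq by auto
  then show ?thesis
    using assms supermodular_cong[of n f g] unfolding standard_supermodular_def by auto
qed

lemma flat_cong:
  assumes "flat f" and eq: "\<And>I. I \<subseteq> N \<Longrightarrow> f I = g I"
  shows "flat g"
proof -
  have "slack g I J = slack f I J" if "I \<subseteq> N" "J \<subseteq> N" for I J
    using that by (simp add: slack_def eq le_infI1)
  then show ?thesis using assms(1) unfolding flat_def by auto
qed

lemma bij_betw_ray:
  "bij_betw (\<lambda>S. restrict (ray S) (Pow N)) {S. good S} (K_set n t - {alpha n t, alpha n (t + 1)})"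
proof (rule bij_betw_imageI)
  show "inj_on (\<lambda>S. restrict (ray S) (Pow N)) {S. good S}"
  proof (rule inj_onI)
    fix S S' assume SS: "S \<in> {S. good S}" "S' \<in> {S. good S}"
      and eq: "restrict (ray S) (Pow N) = restrict (ray S') (Pow N)"
    have "ray S I = ray S' I" if "I \<subseteq> N" for I using fun_cong[OF eq, of I] that by simp
    with SS show "S = S'" using ray_inject[of S S'] unfolding good_def by blast
  qed
  show "(\<lambda>S. restrict (ray S) (Pow N)) ` {S. good S} = K_set n t - {alpha n t, alpha n (t + 1)}"
  proof (intro equalityI subsetI)
    fix f assume "f \<in> (\<lambda>S. restrict (ray S) (Pow N)) ` {S. good S}"
    then obtain S where S: "good S" and f: "f = restrict (ray S) (Pow N)" by blast
    have pr: "proper S" using S unfolding good_def by blast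
    have eq: "ray S I = f I" if "I \<subseteq> N" for I using that f by simp
    have "flat (ray S)" unfolding ray_def using flat_ramp cone_weight pr by blast
    then have "flat f" by (rule flat_cong) (rule eq)
    moreover have "standard_supermodular n f" using standard_ray[OF pr] by (rule standard_cong) (rule eq)
    moreover have "irreducible_supermodular n f"
      using irreducible_ray[OF S] by (rule irreducible_cong) (rule eq)
    moreover have "f \<in> extensional (Pow N)" unfolding f by simp
    moreover have "f \<noteq> alpha n t" "f \<noteq> alpha n (t + 1)"
      using ray_not_alpha[OF pr, of t] ray_not_alpha[OF pr, of "t + 1"] eq by auto
    ultimately show "f \<in> K_set n t - {alpha n t, alpha n (t + 1)}"
      by (simp add: K_set_iff)
  next
    fix f assume f: "f \<in> K_set n t - {alpha n t, alpha n (t + 1)}"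
    then have K: "f \<in> extensional (Pow N)" "standard_supermodular n f"
      "irreducible_supermodular n f" "flat f" by (simp_all add: K_set_iff)
    \<comment> \<open>Extensionality upgrades agreement on subsets of \<open>N\<close> to equality
      of functions, as needed to exclude the two \<open>alpha\<close> cases.\<close>
    have "alpha n u \<in> extensional (Pow N)" for u unfolding alpha_def by simp
    then have "f = alpha n u" if "\<forall>I \<subseteq> N. f I = alpha n u I" for u
      using K(1) that by (metis PowD extensionalityI)
    then obtain S where S: "good S" "\<forall>I \<subseteq> N. f I = ray S I"
      using irreducible_cases[OF K(3,2,4)] f by blast
    have "f = restrict (ray S) (Pow N)"
      using K(1) S(2) by (intro extensionalityI[of _ "Pow N"]) auto
    then show "f \<in> (\<lambda>S. restrict (ray S) (Pow N)) ` {S. good S}" using S(1) by blast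
  qed
qed

end

theorem theorem7p1:
  fixes n t :: nat
  assumes "n \<ge> 3" and "t \<in> {1..n - 2}"
  shows "bij_betw
           (\<lambda>S. \<lambda>I \<in> Pow {1..n}.
              (\<Sum>k\<in>S. beta n t k I)
              - max 0 (real (card S) - (real t + 1)) * alpha n t I
              - max 0 (real (card S) - (real n - real t)) * alpha n (t + 1) I)
           {S. S \<subseteq> {1..n} \<and>
               (card S \<in> {1, n - 1} \<or>
                min (t + 1) (n - t) < card S \<and> card S < max (t + 1) (n - t)) \<and>
               \<not> (n = 3 \<and> card S = 2)}
           (K_set n t - {alpha n t, alpha n (t + 1)})"
proof -
  interpret two_levels n t using assms by unfold_locales auto
  have "good S \<Longrightarrow> restrict (ray S) (Pow N) = (\<lambda>I \<in> Pow N. (\<Sum>k\<in>S. beta n t k I)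
      - max 0 (real (card S) - (real t + 1)) * alpha n t I
      - max 0 (real (card S) - (real n - real t)) * alpha n (t + 1) I)" for S
    using ray_formula[of S] unfolding good_def by (intro restrict_ext) auto
  then show ?thesis
    using bij_betw_ray unfolding good_iff[symmetric] by (subst (asm) bij_betw_cong) auto
qed

end
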